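(* Let $q=2^{s}$ with $s\ge 2$ and let $r=q+1$. Then there are at least $q+1$ pairwise non-isomorphic $(\{r,2r-3\};5)$-cages.
   Context: All graphs are finite, undirected and simple. The girth of a graph is the length of a shortest cycle. For integers $2\le r<m$, an $(\{r,m\};g)$-graph is a graph of girth exactly $g$ whose set of vertex degrees is exactly $\{r,m\}$, and an $(\{r,m\};g)$-cage is an $(\{r,m\};g)$-graph of minimum possible order. *)

theory Defs
  imports
    "Graph_Theory.Pair_Digraph"
    "Graph_Theory.Digraph_Isomorphism"
    "HOL-Library.Extended_Nat"
begin

text \<open>
  A finite simple undirected graph is a \<^locale>\<open>pair_graph\<close>: a finite, loopless, symmetric
  digraph without parallel arcs, an edge being represented by its two opposite arcs. Hence the
  degree of a vertex is its \<^const>\<open>out_degree\<close>, and \<^const>\<open>digraph_iso\<close> is graph isomorphism.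
\<close>

text \<open>
  The bound on the length excludes the closed walks $u, v, u$ along a single edge, which are
  cycles of a symmetric digraph but not of the undirected graph.
\<close>
definition undirected_cycle :: "'a pair_pre_digraph \<Rightarrow> ('a \<times> 'a) awalk \<Rightarrow> bool" where
  "undirected_cycle G p \<longleftrightarrow> pre_digraph.cycle (with_proj G) p \<and> 3 \<le> length p"

text \<open>The girth of a forest is \<open>\<infinity>\<close>.\<close>
definition girth :: "'a pair_pre_digraph \<Rightarrow> enat" where
  "girth G = (INF p \<in> {p. undirected_cycle G p}. enat (length p))"

definition rm_graph :: "nat \<Rightarrow> nat \<Rightarrow> nat \<Rightarrow> 'a pair_pre_digraph \<Rightarrow> bool" where
  "rm_graph r m g G \<longleftrightarrow>
     pair_graph G \<and> girth G = enat g \<and> out_degree (with_proj G) ` pverts G = {r, m}"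

text \<open>
  The competitors \<open>H\<close> may be taken with vertices in \<^typ>\<open>nat\<close>, since every finite graph is
  isomorphic to such a graph.
\<close>
definition rm_cage :: "nat \<Rightarrow> nat \<Rightarrow> nat \<Rightarrow> 'a pair_pre_digraph \<Rightarrow> bool" where
  "rm_cage r m g G \<longleftrightarrow>
     rm_graph r m g G \<and>
     (\<forall>H :: nat pair_pre_digraph. rm_graph r m g H \<longrightarrow> card (pverts G) \<le> card (pverts H))"

end

theory Submission
  imports Defs "HOL-Library.Z2" "HOL-Algebra.Algebraic_Closure_Type"
begin

text \<open>
  Counting the vertices within distance two of a vertex of degree \<open>m = 2q - 1\<close> shows that an
  \<open>({r, m}; 5)\<close>-graph has at least \<open>m r + 1 = 2q\<^sup>2 + q\<close> vertices. This is the order of the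
  incidence graph of an affine plane of order \<open>q\<close>, in which points have degree \<open>q + 1\<close> and lines
  have degree \<open>q\<close>. Two parallel lines are at distance four in it, so edges may be added
  inside a parallel class without creating cycles of length less than five, as long as the graph
  added to the class has none. For \<open>q\<close> even each class can be given either a star, whose centre
  then has degree \<open>2q - 1\<close> and whose leaves have degree \<open>q + 1\<close>, or a perfect matching. With
  stars in exactly \<open>k\<close> of the \<open>q + 1\<close> classes there are \<open>k\<close> vertices of degree \<open>m\<close>, so
  \<open>k = 1, \<dots>, q + 1\<close> gives pairwise non-isomorphic cages.
\<close>

section \<open>Degrees, short cycles and girth five\<close>

lemma out_degree_with_proj: "out_degree (with_proj G) u = card {v. (u, v) \<in> parcs G}"
proof -
  have "out_arcs (with_proj G) u = Pair u ` {v. (u, v) \<in> parcs G}"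
    by (auto simp: out_arcs_def)
  then show ?thesis
    by (simp add: out_degree_def card_image inj_on_def)
qed

lemma undirected_cycle_triangle:
  assumes "pair_graph G" "(u, v) \<in> parcs G" "(v, w) \<in> parcs G" "(w, u) \<in> parcs G"
  shows "undirected_cycle G [(u, v), (v, w), (w, u)]"
proof -
  interpret pair_graph G by fact
  show ?thesis
    using assms no_loops' unfolding undirected_cycle_def cycle_def
    by (intro conjI exI[of _ u]) (auto simp: awalk_def intro: in_arcsD1)
qed

lemma undirected_cycle_square:
  assumes "pair_graph G" "(u, v) \<in> parcs G" "(v, w) \<in> parcs G" "(w, x) \<in> parcs G"
    "(x, u) \<in> parcs G" "u \<noteq> w" "v \<noteq> x"
  shows "undirected_cycle G [(u, v), (v, w), (w, x), (x, u)]"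
proof -
  interpret pair_graph G by fact
  show ?thesis
    using assms no_loops' unfolding undirected_cycle_def cycle_def
    by (intro conjI exI[of _ u]) (auto simp: awalk_def intro: in_arcsD1)
qed

lemma undirected_cycle_pentagon:
  assumes "pair_graph G" "(a, b) \<in> parcs G" "(b, c) \<in> parcs G" "(c, d) \<in> parcs G"
    "(d, e) \<in> parcs G" "(e, a) \<in> parcs G" "distinct [a, b, c, d, e]"
  shows "undirected_cycle G [(a, b), (b, c), (c, d), (d, e), (e, a)]"
proof -
  interpret pair_graph G by fact
  show ?thesis
    using assms unfolding undirected_cycle_def cycle_def
    by (intro conjI exI[of _ a]) (auto simp: awalk_def intro: in_arcsD1)
qed

lemma undirected_cycle_length_ge_girth:
  "undirected_cycle G p \<Longrightarrow> girth G \<le> enat (length p)"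
  unfolding girth_def by (rule INF_lower) simp

text \<open>Undirected cycles have length at least 3 by definition, so only lengths 3 and 4 have to
  be excluded; \<open>p\<close> gives the upper bound.\<close>

lemma girth_eq_5I:
  assumes G: "pair_graph G"
    and tri: "\<And>u v w. (u, v) \<in> parcs G \<Longrightarrow> (v, w) \<in> parcs G \<Longrightarrow> (w, u) \<notin> parcs G"
    and sq: "\<And>u v w x. (u, v) \<in> parcs G \<Longrightarrow> (v, w) \<in> parcs G \<Longrightarrow> (w, x) \<in> parcs G \<Longrightarrow>
      (x, u) \<in> parcs G \<Longrightarrow> u = w \<or> v = x"
    and pent: "undirected_cycle G p" "length p = 5"
  shows "girth G = 5"
proof (rule antisym)
  show "girth G \<le> 5"
    using undirected_cycle_length_ge_girth[OF pent(1)] pent(2) by (simp add: numeral_eq_enat)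
  interpret pair_graph G by fact
  have "5 \<le> length c" if c: "undirected_cycle G c" for c
  proof (rule ccontr)
    assume "\<not> 5 \<le> length c"
    moreover have "3 \<le> length c"
      using c by (simp add: undirected_cycle_def)
    ultimately consider "length c = 3" | "length c = 4"
      by linarith
    then show False
    proof cases
      case 1
      then obtain t u v w x y where "c = [(t, u), (v, w), (x, y)]"
        by (auto simp: eval_nat_numeral length_Suc_conv)
      then show False
        using c tri[of t v x] unfolding undirected_cycle_def cycle_def awalk_def by auto
    next
      case 2
      then obtain r s t u v w x y where "c = [(r, s), (t, u), (v, w), (x, y)]"
        by (auto simp: eval_nat_numeral length_Suc_conv)
      then show False
        using c sq[of r t v x] unfolding undirected_cycle_def cycle_def awalk_def by auto
    qed
  qed
  then show "5 \<le> girth G"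
    unfolding girth_def by (auto intro!: INF_greatest simp: numeral_eq_enat)
qed

text \<open>The sets \<open>B u\<close>, for \<open>u\<close> a neighbour of \<open>v\<close>, arise
  from the neighbourhood of \<open>u\<close> by trading \<open>v\<close> for \<open>u\<close>, so
  each has at least \<open>r\<close> elements. They are pairwise disjoint and avoid
  \<open>v\<close>, which accounts for the final 1.\<close>

lemma order_ge_of_girth_5:
  assumes G: "pair_graph G" and girth: "girth G = 5"
    and min: "\<And>u. u \<in> pverts G \<Longrightarrow> r \<le> out_degree (with_proj G) u"
    and v: "v \<in> pverts G"
  shows "out_degree (with_proj G) v * r + 1 \<le> card (pverts G)"
proof -
  interpret pair_graph G by fact
  define N where "N u = {w. (u, w) \<in> parcs G}" for u
  define B where "B u = insert u (N u - {v})" for u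
  have deg: "out_degree (with_proj G) u = card (N u)" for u
    by (simp add: N_def out_degree_with_proj)
  have sub: "N u \<subseteq> pverts G" for u
    by (auto simp: N_def intro: in_arcsD2)
  then have fin: "finite (N u)" for u
    using pair_finite_verts finite_subset by blast
  have long: "5 \<le> length p" if "undirected_cycle G p" for p
    using undirected_cycle_length_ge_girth[OF that] girth by (simp add: numeral_eq_enat)
  have tri: "(w, u) \<notin> parcs G" if "(u, x) \<in> parcs G" "(x, w) \<in> parcs G" for u x w
    using long undirected_cycle_triangle[OF G that] by force
  have sq: "u = w \<or> x = y" if "(u, x) \<in> parcs G" "(x, w) \<in> parcs G" "(w, y) \<in> parcs G"
    "(y, u) \<in> parcs G" for u x w y
    using long undirected_cycle_square[OF G that] by force
  \<comment> \<open>An overlap containing \<open>u\<close> or \<open>u'\<close> closes a triangle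
    through \<open>v\<close>; any other common element is a second common neighbour of
    \<open>u\<close> and \<open>u'\<close> besides \<open>v\<close> and closes a 4-cycle.\<close>
  have disj: "B u \<inter> B u' = {}" if "u \<in> N v" "u' \<in> N v" "u \<noteq> u'" for u u'
    using that tri[of v u u'] tri[of v u' u] sq[of v u _ u'] arcs_symmetric
    unfolding B_def N_def by blast
  have cardB: "r \<le> card (B u)" if "u \<in> N v" for u
  proof -
    have "v \<in> N u" "u \<notin> N u"
      using that arcs_symmetric no_loops' by (auto simp: N_def)
    then have "card (B u) = card (N u)"
      using fin card_gt_0_iff[of "N u"] by (auto simp: B_def)
    then show ?thesis
      using min[of u] sub that deg by auto
  qed
  have "card (N v) * r \<le> (\<Sum>u\<in>N v. card (B u))"
    using sum_mono[of "N v" "\<lambda>_. r" "\<lambda>u. card (B u)"] cardB by simp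
  also have "\<dots> = card (\<Union>u\<in>N v. B u)"
    using fin disj by (subst card_UN_disjoint) (auto simp: B_def)
  finally have "card (N v) * r + 1 \<le> card (insert v (\<Union>u\<in>N v. B u))"
    using fin no_loops' by (subst card_insert_disjoint) (auto simp: B_def N_def)
  also have "\<dots> \<le> card (pverts G)"
    using v sub by (intro card_mono pair_finite_verts) (auto simp: B_def)
  finally show ?thesis
    by (simp add: deg)
qed

text \<open>This is the invariant that tells the cages apart.\<close>

lemma digraph_iso_card_degree:
  assumes "digraph_iso G H"
  shows "card {v \<in> verts G. out_degree G v = d} = card {v \<in> verts H. out_degree H v = d}"
proof -
  obtain f where f: "pre_digraph.digraph_isomorphism G f" "H = app_iso f G"
    using assms unfolding digraph_iso_def by blast
  then interpret wf_digraph G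
    by (simp add: pre_digraph.digraph_isomorphism_def)
  have "{v \<in> verts H. out_degree H v = d} = iso_verts f ` {v \<in> verts G. out_degree G v = d}"
    using out_degree_app_iso_eq[OF f(1)] f(2) by auto
  moreover have "inj_on (iso_verts f) {v \<in> verts G. out_degree G v = d}"
    using digraph_isomorphism_inj_on_verts[OF f(1)] by (rule inj_on_subset) auto
  ultimately show ?thesis
    by (simp add: card_image)
qed

section \<open>The field with \<open>2 ^ s\<close> elements\<close>

lemma card_roots_separable:
  fixes p :: "'a :: alg_closed_field poly"
  assumes sep: "\<And>x. poly p x = 0 \<Longrightarrow> poly (pderiv p) x \<noteq> 0"
  shows "card {x. poly p x = 0} = degree p"
proof -
  have "p \<noteq> 0"
    using sep[of 0] by auto
  \<comment> \<open>A root of order at least two is also a root of the derivative.\<close>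
  have order: "order x p = 1" if "poly p x = 0" for x
  proof (rule ccontr)
    assume "order x p \<noteq> 1"
    moreover have "order x p \<noteq> 0"
      using that \<open>p \<noteq> 0\<close> by (simp add: order_root)
    ultimately have "[:-x, 1:] ^ 2 dvd p"
      using \<open>p \<noteq> 0\<close> by (simp add: order_divides)
    then obtain r where "p = [:-x, 1:] * ([:-x, 1:] * r)"
      by (auto simp: power2_eq_square mult.assoc simp del: mult_pCons_left mult_pCons_right)
    then have "poly (pderiv p) x = 0"
      by (simp add: pderiv_mult del: mult_pCons_left mult_pCons_right)
    then show False
      using sep that by blast
  qed
  from \<open>p \<noteq> 0\<close> obtain A
    where A: "size A = degree p" "p = smult (lead_coeff p) (\<Prod>x\<in>#A. [:-x, 1:])"
    using alg_closed_imp_factorization by blast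
  have *: "proots (\<Prod>x\<in>#B. [:-x, 1:]) = B" for B :: "'a multiset"
  proof (induction B)
    case (add x B)
    have "(\<Prod>x\<in>#B. [:-x, 1:]) \<noteq> 0"
      by (auto simp: prod_mset_zero_iff)
    then show ?case
      by (simp add: proots_mult add del: mult_pCons_left)
  qed simp
  have "proots p = A"
    using A(2) * \<open>p \<noteq> 0\<close> by (metis leading_coeff_0_iff proots_smult)
  moreover have "count (proots p) x = 1" if "x \<in># proots p" for x
    using that order \<open>p \<noteq> 0\<close> by simp
  ultimately show ?thesis
    using A(1) \<open>p \<noteq> 0\<close> by (simp add: size_multiset_overloaded_eq flip: set_count_proots)
qed

lemma two_eq_0_bit_closure: "(2 :: bit alg_closure) = 0"
  by (metis bit_numeral_even to_ac_0 to_ac_numeral)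

text \<open>For \<open>s \<ge> 1\<close> this is the subfield with \<open>2 ^ s\<close> elements,
  given as the fixed points of an iterated Frobenius map.\<close>

definition gf2 :: "nat \<Rightarrow> bit alg_closure set" where
  "gf2 s = {x. x ^ 2 ^ s = x}"

text \<open>Squaring is additive because the mixed term has the factor 2, which is 0; iterate
  \<open>s\<close> times.\<close>

lemma frobenius_add_bit_closure:
  "(x + y) ^ 2 ^ s = x ^ 2 ^ s + (y :: bit alg_closure) ^ 2 ^ s"
  by (induction s) (simp_all add: power_mult power2_sum two_eq_0_bit_closure mult.commute[of 2])

lemma uminus_bit_closure: "- x = (x :: bit alg_closure)"
  by (metis add_eq_0_iff mult_2 mult_zero_left two_eq_0_bit_closure)

text \<open>The closure property that keeps intercepts of lines in the field. Negation is the
  identity in characteristic 2, so additivity of the Frobenius map covers the difference.\<close>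

lemma gf2_diff_mult:
  assumes "x \<in> gf2 s" "y \<in> gf2 s" "z \<in> gf2 s"
  shows "x - y * z \<in> gf2 s"
  using assms frobenius_add_bit_closure[of x "y * z" s]
  by (simp add: gf2_def power_mult_distrib diff_conv_add_uminus uminus_bit_closure
      del: add_uminus_conv_diff)

text \<open>The elements are the roots of \<open>X ^ 2 ^ s - X\<close>, whose derivative is the
  constant -1, so there are no multiple roots.\<close>

lemma card_gf2:
  assumes "s \<ge> 1"
  shows "card (gf2 s) = 2 ^ s"
proof -
  define p :: "bit alg_closure poly" where "p = monom 1 (2 ^ s) - monom 1 1"
  have gt: "(2 :: nat) ^ s > 1"
    using assms by (intro one_less_power) auto
  have "degree p = 2 ^ s"
    unfolding p_def diff_conv_add_uminus using gt
    by (subst degree_add_eq_left) (simp_all add: degree_monom_eq)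
  moreover have "pderiv p = [:-1:]"
    using assms by (simp add: p_def pderiv_diff pderiv_monom two_eq_0_bit_closure
        power_0_left monom_0)
  moreover have "{x. poly p x = 0} = gf2 s"
    by (auto simp: p_def gf2_def poly_monom)
  ultimately show ?thesis
    using card_roots_separable[of p] by simp
qed

text \<open>The affine plane over the field with \<open>q\<close> elements, with points and lines
  renumbered by naturals. Injectivity says that two points lie on at most one common line.\<close>

lemma ex_orthogonal_array:
  fixes q :: nat
  assumes "s \<ge> 1" "q = 2 ^ s"
  obtains L :: "nat \<Rightarrow> nat \<Rightarrow> nat" where
    "\<And>c p. c \<le> q \<Longrightarrow> p < q\<^sup>2 \<Longrightarrow> L c p < q"
    "\<And>c d. c \<le> q \<Longrightarrow> d \<le> q \<Longrightarrow> c \<noteq> d \<Longrightarrow> inj_on (\<lambda>p. (L c p, L d p)) {..<q\<^sup>2}"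
proof -
  let ?F = "gf2 s"
  have card: "card ?F = q"
    using card_gf2 assms by simp
  moreover have "q > 0"
    using assms by simp
  ultimately have fin: "finite ?F"
    using card.infinite by fastforce
  \<comment> \<open>\<open>h\<close> numbers the lines of a class by their intercepts,
    \<open>a\<close> enumerates the slopes, and \<open>g\<close> assigns coordinates to the
    points.\<close>
  obtain h where h: "bij_betw h ?F {..<q}"
    using fin card by (metis atLeast0LessThan ex_bij_betw_finite_nat)
  obtain a where a: "bij_betw a {..<q} ?F"
    using h bij_betw_inv by blast
  have "card (?F \<times> ?F) = q\<^sup>2" "finite (?F \<times> ?F)"
    using fin card by (simp_all add: power2_eq_square)
  then obtain g where g: "bij_betw g {..<q\<^sup>2} (?F \<times> ?F)"
    by (metis atLeast0LessThan ex_bij_betw_nat_finite)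
  \<comment> \<open>Class \<open>c < q\<close> has slope \<open>a c\<close> and its lines are told apart by their intercepts; class \<open>q\<close> is vertical.\<close>
  define l where "l c z = (if c < q then snd z - a c * fst z else fst z)" for c z
  have aF: "a c \<in> ?F" if "c < q" for c
    using a that by (auto dest: bij_betwE)
  have lF: "l c (x, y) \<in> ?F" if "x \<in> ?F" "y \<in> ?F" for c x y
    using that aF by (auto simp: l_def gf2_diff_mult)
  have linj: "z = z'" if "c \<le> q" "d \<le> q" "c < d" "l c z = l c z'" "l d z = l d z'" for c d z z'
  proof (cases "d < q")
    case True
    \<comment> \<open>Both classes have slopes here, since \<open>c < d < q\<close>. Subtracting the
      two intercept differences cancels the second coordinates.\<close>
    have "(a d - a c) * (fst z - fst z') = (l c z - l c z') - (l d z - l d z')"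
      using that(3) True by (simp add: l_def algebra_simps)
    then have "(a d - a c) * (fst z - fst z') = 0"
      using that by simp
    moreover have "a c \<noteq> a d"
      using a that True by (auto dest!: bij_betw_imp_inj_on dest: inj_onD)
    ultimately show ?thesis
      using that True by (auto simp: l_def prod_eq_iff)
  next
    case False
    then show ?thesis
      using that by (auto simp: l_def prod_eq_iff)
  qed
  have linj': "z = z'" if "c \<le> q" "d \<le> q" "c \<noteq> d" "l c z = l c z'" "l d z = l d z'" for c d z z'
    using linj[of c d z z'] linj[of d c z z'] that by linarith
  show thesis
  proof (rule that[of "\<lambda>c p. h (l c (g p))"])
    fix c p assume "c \<le> q" "p < q\<^sup>2"
    then have "g p \<in> ?F \<times> ?F"
      using g by (auto dest: bij_betwE)
    then show "h (l c (g p)) < q"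
      using lF h by (cases "g p") (auto dest: bij_betwE)
  next
    fix c d assume cd: "c \<le> q" "d \<le> q" "c \<noteq> d"
    show "inj_on (\<lambda>p. (h (l c (g p)), h (l d (g p)))) {..<q\<^sup>2}"
    proof (rule inj_onI)
      fix p p' assume p: "p \<in> {..<q\<^sup>2}" "p' \<in> {..<q\<^sup>2}"
        and eq: "(h (l c (g p)), h (l d (g p))) = (h (l c (g p')), h (l d (g p')))"
      have F: "l e (g t) \<in> ?F" if "t \<in> {..<q\<^sup>2}" for e t
        using bij_betwE[OF g] that lF by (cases "g t") force
      have "l e (g p) = l e (g p')" if "e \<in> {c, d}" for e
        using that eq F p bij_betw_imp_inj_on[OF h] by (auto dest: inj_onD)
      then have "g p = g p'"
        using linj' cd by blast
      then show "p = p'"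
        using p bij_betw_imp_inj_on[OF g] by (auto dest: inj_onD)
    qed
  qed
qed

section \<open>The graph on the points and lines of an affine plane\<close>

definition Pt :: "nat \<Rightarrow> nat" where
  "Pt p = prod_encode (0, p)"

text \<open>The first component 0 is reserved for points, hence the shift of the class by
  one.\<close>

definition Ln :: "nat \<Rightarrow> nat \<Rightarrow> nat" where
  "Ln c i = prod_encode (Suc c, i)"

lemma pt_ln_simps [simp]:
  "Pt p = Pt p' \<longleftrightarrow> p = p'" "Ln c i = Ln d j \<longleftrightarrow> c = d \<and> i = j"
  "Pt p \<noteq> Ln c i" "Ln c i \<noteq> Pt p"
  by (simp_all add: Pt_def Ln_def prod_encode_eq)

text \<open>
  Points are numbered by \<open>p < q\<^sup>2\<close> and parallel classes by \<open>c \<le> q\<close>; \<open>L c p\<close> is the number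
  of the line of class \<open>c\<close> through \<open>p\<close>, and \<open>E c\<close> is the graph added to class \<open>c\<close>.
\<close>
definition amalgam ::
  "nat \<Rightarrow> (nat \<Rightarrow> nat \<Rightarrow> nat) \<Rightarrow> (nat \<Rightarrow> nat \<Rightarrow> nat \<Rightarrow> bool) \<Rightarrow> nat pair_pre_digraph" where
  "amalgam q L E = \<lparr>
     pverts = Pt ` {..<q\<^sup>2} \<union> (\<lambda>(c, i). Ln c i) ` ({..q} \<times> {..<q}),
     parcs = {(Pt p, Ln c (L c p)) | p c. p < q\<^sup>2 \<and> c \<le> q}
       \<union> {(Ln c (L c p), Pt p) | p c. p < q\<^sup>2 \<and> c \<le> q}
       \<union> {(Ln c i, Ln c j) | c i j. c \<le> q \<and> i < q \<and> j < q \<and> E c i j} \<rparr>"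

lemma amalgam_arc_iff [simp]:
  "(Pt p, Pt p') \<notin> parcs (amalgam q L E)"
  "(Pt p, Ln c i) \<in> parcs (amalgam q L E) \<longleftrightarrow> p < q\<^sup>2 \<and> c \<le> q \<and> L c p = i"
  "(Ln c i, Pt p) \<in> parcs (amalgam q L E) \<longleftrightarrow> p < q\<^sup>2 \<and> c \<le> q \<and> L c p = i"
  "(Ln c i, Ln d j) \<in> parcs (amalgam q L E) \<longleftrightarrow>
    c = d \<and> c \<le> q \<and> i < q \<and> j < q \<and> E c i j"
  by (auto simp: amalgam_def)

lemma amalgam_vert_iff [simp]:
  "Pt p \<in> pverts (amalgam q L E) \<longleftrightarrow> p < q\<^sup>2"
  "Ln c i \<in> pverts (amalgam q L E) \<longleftrightarrow> c \<le> q \<and> i < q"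
  by (auto simp: amalgam_def)

lemma amalgam_vert_cases [consumes 1, case_names Pt Ln]:
  assumes "v \<in> pverts (amalgam q L E)"
  obtains p where "v = Pt p" "p < q\<^sup>2" | c i where "v = Ln c i" "c \<le> q" "i < q"
  using assms by (auto simp: amalgam_def)

lemma card_amalgam: "card (pverts (amalgam q L E)) = q\<^sup>2 + (q + 1) * q"
proof -
  have "card (Pt ` {..<q\<^sup>2}) = q\<^sup>2"
    by (subst card_image) (auto simp: inj_on_def)
  moreover have "card ((\<lambda>(c, i). Ln c i) ` ({..q} \<times> {..<q})) = (q + 1) * q"
    by (subst card_image) (auto simp: inj_on_def)
  moreover have "Pt ` {..<q\<^sup>2} \<inter> (\<lambda>(c, i). Ln c i) ` ({..q} \<times> {..<q}) = {}"
    by auto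
  ultimately show ?thesis
    by (simp add: amalgam_def card_Un_disjoint)
qed

locale net =
  fixes q :: nat and L :: "nat \<Rightarrow> nat \<Rightarrow> nat"
  assumes q_pos: "q > 0"
    and L_less: "c \<le> q \<Longrightarrow> p < q\<^sup>2 \<Longrightarrow> L c p < q"
    and L_inj: "c \<le> q \<Longrightarrow> d \<le> q \<Longrightarrow> c \<noteq> d \<Longrightarrow> inj_on (\<lambda>p. (L c p, L d p)) {..<q\<^sup>2}"
begin

text \<open>Both sides have \<open>q\<^sup>2\<close> elements, so injectivity upgrades to
  bijectivity: lines of different classes meet in exactly one point.\<close>

lemma L_bij:
  assumes "c \<le> q" "d \<le> q" "c \<noteq> d"
  shows "bij_betw (\<lambda>p. (L c p, L d p)) {..<q\<^sup>2} ({..<q} \<times> {..<q})"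
proof (rule bij_betw_imageI)
  show inj: "inj_on (\<lambda>p. (L c p, L d p)) {..<q\<^sup>2}"
    using L_inj assms by blast
  have "(\<lambda>p. (L c p, L d p)) ` {..<q\<^sup>2} \<subseteq> {..<q} \<times> {..<q}"
    using L_less assms(1,2) by blast
  then show "(\<lambda>p. (L c p, L d p)) ` {..<q\<^sup>2} = {..<q} \<times> {..<q}"
    by (rule card_subset_eq[rotated]) (simp_all add: card_image[OF inj], simp add: power2_eq_square)
qed

lemma common_point:
  assumes "c \<le> q" "d \<le> q" "c \<noteq> d" "i < q" "j < q"
  obtains p where "p < q\<^sup>2" "L c p = i" "L d p = j"
proof -
  have "(i, j) \<in> (\<lambda>p. (L c p, L d p)) ` {..<q\<^sup>2}"
    using L_bij[OF assms(1-3)] assms by (simp add: bij_betw_def)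
  then show thesis
    using that by auto
qed

lemma point_eqI:
  assumes "c \<le> q" "d \<le> q" "c \<noteq> d" "p < q\<^sup>2" "p' < q\<^sup>2" "L c p = L c p'" "L d p = L d p'"
  shows "p = p'"
  using L_inj[of c d] assms by (auto dest: inj_onD)

text \<open>The \<open>q\<close> lines of any other class \<open>d\<close> cut the given line in one
  point each, and these are all its points.\<close>

lemma card_line:
  assumes "c \<le> q" "i < q"
  shows "card {p. p < q\<^sup>2 \<and> L c p = i} = q"
proof -
  obtain d where d: "d \<le> q" "c \<noteq> d"
    using q_pos by (metis le0 neq0_conv order_refl)
  have "bij_betw (L d) {p. p < q\<^sup>2 \<and> L c p = i} {..<q}"
  proof (rule bij_betw_imageI)
    show "inj_on (L d) {p. p < q\<^sup>2 \<and> L c p = i}"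
      using point_eqI[OF assms(1) d] by (auto intro!: inj_onI)
    have "j \<in> L d ` {p. p < q\<^sup>2 \<and> L c p = i}" if "j < q" for j
      using common_point[OF assms(1) d assms(2) that] by blast
    then show "L d ` {p. p < q\<^sup>2 \<and> L c p = i} = {..<q}"
      using L_less[OF d(1)] by blast
  qed
  then show ?thesis
    by (simp add: bij_betw_same_card)
qed

lemma out_degree_Pt:
  assumes "p < q\<^sup>2"
  shows "out_degree (with_proj (amalgam q L E)) (Pt p) = q + 1"
proof -
  have "{v. (Pt p, v) \<in> parcs (amalgam q L E)} = (\<lambda>c. Ln c (L c p)) ` {..q}"
    using assms by (auto simp: amalgam_def)
  then show ?thesis
    by (simp add: out_degree_with_proj card_image inj_on_def)
qed

lemma out_degree_Ln:
  assumes "c \<le> q" "i < q"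
  shows "out_degree (with_proj (amalgam q L E)) (Ln c i) = q + card {j. j < q \<and> E c i j}"
proof -
  have "{v. (Ln c i, v) \<in> parcs (amalgam q L E)} =
      Pt ` {p. p < q\<^sup>2 \<and> L c p = i} \<union> Ln c ` {j. j < q \<and> E c i j}"
    using assms by (auto simp: amalgam_def)
  moreover have "card (Pt ` {p. p < q\<^sup>2 \<and> L c p = i} \<union> Ln c ` {j. j < q \<and> E c i j}) =
      card {p. p < q\<^sup>2 \<and> L c p = i} + card {j. j < q \<and> E c i j}"
    by (subst card_Un_disjoint) (auto simp: card_image inj_on_def)
  ultimately show ?thesis
    unfolding out_degree_with_proj card_line[OF assms] by simp
qed

lemma pair_graph_amalgam:
  assumes "\<And>c i j. E c i j \<Longrightarrow> E c j i" "\<And>c i. \<not> E c i i"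
  shows "pair_graph (amalgam q L E)"
proof
  have V: "fst e \<in> pverts (amalgam q L E) \<and> snd e \<in> pverts (amalgam q L E)"
    if "e \<in> parcs (amalgam q L E)" for e
  proof -
    from that consider p c where "e = (Pt p, Ln c (L c p))" "p < q\<^sup>2" "c \<le> q"
      | p c where "e = (Ln c (L c p), Pt p)" "p < q\<^sup>2" "c \<le> q"
      | c i j where "e = (Ln c i, Ln c j)" "c \<le> q" "i < q" "j < q"
      unfolding amalgam_def by auto
    then show ?thesis
      by cases (simp_all add: L_less)
  qed
  then show "fst e \<in> pverts (amalgam q L E)" "snd e \<in> pverts (amalgam q L E)"
    if "e \<in> parcs (amalgam q L E)" for e
    using that by auto
  show fin: "finite (pverts (amalgam q L E))"
    by (simp add: amalgam_def)
  have "parcs (amalgam q L E) \<subseteq> pverts (amalgam q L E) \<times> pverts (amalgam q L E)"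
    using V by (auto simp: mem_Times_iff)
  then show "finite (parcs (amalgam q L E))"
    using fin finite_subset by blast
  show "fst e \<noteq> snd e" if "e \<in> parcs (amalgam q L E)" for e
    using that assms(2) by (auto simp: amalgam_def)
  show "symmetric (with_proj (amalgam q L E))"
    unfolding symmetric_def with_proj_simps
    by (rule symI) (use assms(1) in \<open>auto simp: amalgam_def\<close>)
qed

text \<open>
  An edge between two parallel lines lies on a pentagon: join the two lines through a common
  transversal.
\<close>
lemma girth_amalgam:
  assumes sym: "\<And>c i j. E c i j \<Longrightarrow> E c j i" and irrefl: "\<And>c i. \<not> E c i i"
    and tri: "\<And>c i j k. E c i j \<Longrightarrow> E c j k \<Longrightarrow> \<not> E c k i"
    and sq: "\<And>c i j k l. E c i j \<Longrightarrow> E c j k \<Longrightarrow> E c k l \<Longrightarrow> E c l i \<Longrightarrow> i = k \<or> j = l"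
    and edge: "c \<le> q" "i < q" "j < q" "E c i j"
  shows "girth (amalgam q L E) = 5"
proof -
  let ?G = "amalgam q L E"
  have G: "pair_graph ?G"
    using pair_graph_amalgam sym irrefl by blast
  then interpret pair_graph ?G .
  obtain d where d: "d \<le> q" "d \<noteq> c"
    using q_pos by (metis le0 neq0_conv order_refl)
  obtain p where p: "p < q\<^sup>2" "L c p = i" "L d p = 0"
    using common_point[of c d i 0] edge d q_pos by metis
  obtain p' where p': "p' < q\<^sup>2" "L c p' = j" "L d p' = 0"
    using common_point[of c d j 0] edge d q_pos by metis
  have "i \<noteq> j"
    using edge irrefl by blast
  then have pent: "undirected_cycle ?G
      [(Ln c i, Ln c j), (Ln c j, Pt p'), (Pt p', Ln d 0), (Ln d 0, Pt p), (Pt p, Ln c i)]"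
    using edge d p p' by (intro undirected_cycle_pentagon[OF G]) auto
  have nb: "\<exists>e\<le>q. v = Ln e (L e t)" if "(Pt t, v) \<in> parcs ?G" for t v
    using that by (auto simp: amalgam_def)
  have nb': "\<exists>e\<le>q. v = Ln e (L e t)" if "(v, Pt t) \<in> parcs ?G" for t v
    using that by (auto simp: amalgam_def)
  \<comment> \<open>The other two vertices would be lines through \<open>t\<close>; being adjacent
    they are parallel, hence equal, contradicting irreflexivity.\<close>
  have no_tri: False if "(u, v) \<in> parcs ?G" "(v, w) \<in> parcs ?G" "(w, u) \<in> parcs ?G" "u = Pt t"
    for u v w t
    using that nb[of t v] nb'[of w t] irrefl by auto
  \<comment> \<open>\<open>v\<close> and \<open>x\<close> are lines through \<open>t\<close>. If
    \<open>w\<close> is another point, both join it to \<open>t\<close> and so coincide; if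
    \<open>w\<close> is a line, both are parallel to it, and only one line of that class passes
    through \<open>t\<close>.\<close>
  have opp: "v = x" if arcs: "(u, v) \<in> parcs ?G" "(v, w) \<in> parcs ?G" "(w, x) \<in> parcs ?G"
    "(x, u) \<in> parcs ?G" and u: "u = Pt t" "u \<noteq> w" for u v w x t
  proof -
    obtain e f where ef: "e \<le> q" "v = Ln e (L e t)" "f \<le> q" "x = Ln f (L f t)"
      using nb[of t v] nb'[of x t] arcs u by auto
    have "w \<in> pverts ?G"
      using arcs by (auto dest: wellformed')
    then show ?thesis
    proof (cases rule: amalgam_vert_cases)
      case (Pt t')
      then have "L e t = L e t'" "L f t = L f t'" "t < q\<^sup>2" "t' < q\<^sup>2" "t \<noteq> t'"
        using arcs u ef by auto
      then show ?thesis
        using point_eqI[of e f t t'] ef by auto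
    next
      case (Ln e' i)
      then show ?thesis
        using arcs ef by auto
    qed
  qed
  show ?thesis
  proof (rule girth_eq_5I[OF G _ _ pent])
    fix u v w assume *: "(u, v) \<in> parcs ?G" "(v, w) \<in> parcs ?G"
    show "(w, u) \<notin> parcs ?G"
    proof
      assume **: "(w, u) \<in> parcs ?G"
      have V: "u \<in> pverts ?G" "v \<in> pverts ?G" "w \<in> pverts ?G"
        using * by (auto dest: wellformed')
      \<comment> \<open>Rotating the cycle brings each vertex to the front, so all are lines,
        necessarily of one class, and the hypothesis on \<open>E\<close> applies. The 4-cycle below
        is treated alike.\<close>
      have "y \<noteq> Pt t" if "y \<in> {u, v, w}" for y t
        using no_tri[OF * **] no_tri[OF *(2) ** *(1)] no_tri[OF ** *] that by blast
      then obtain e i e' i' e'' i'' where "u = Ln e i" "v = Ln e' i'" "w = Ln e'' i''"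
        using V by (metis amalgam_vert_cases insertCI)
      then show False
        using * ** tri[of e i i' i''] by auto
    qed
  next
    fix u v w x assume *: "(u, v) \<in> parcs ?G" "(v, w) \<in> parcs ?G" "(w, x) \<in> parcs ?G"
      "(x, u) \<in> parcs ?G"
    show "u = w \<or> v = x"
    proof (rule ccontr)
      assume ne: "\<not> (u = w \<or> v = x)"
      have V: "u \<in> pverts ?G" "v \<in> pverts ?G" "w \<in> pverts ?G" "x \<in> pverts ?G"
        using * by (auto dest: wellformed')
      have "y \<noteq> Pt t" if "y \<in> {u, v, w, x}" for y t
        using opp[OF *] opp[OF *(2-4) *(1)] opp[OF *(3,4) *(1,2)] opp[OF *(4) *(1-3)] that ne
        by blast
      then obtain e i e' i' e'' i'' f j where
        "u = Ln e i" "v = Ln e' i'" "w = Ln e'' i''" "x = Ln f j"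
        using V by (metis amalgam_vert_cases insertCI)
      then show False
        using * ne sq[of e i i' i'' j] by auto
    qed
  qed simp
qed

end

section \<open>Stars and matchings in the parallel classes\<close>

text \<open>The star has centre 0, and the matching pairs \<open>2t\<close> with \<open>2t + 1\<close>.\<close>
definition star_or_matching :: "nat \<Rightarrow> nat \<Rightarrow> nat \<Rightarrow> nat \<Rightarrow> bool" where
  "star_or_matching k c i j \<longleftrightarrow>
     (if c < k then (i = 0) \<noteq> (j = 0) else i \<noteq> j \<and> i div 2 = j div 2)"

text \<open>Names the partner in the matching explicitly, which shows that it is unique.\<close>

lemma div2_eq_div2_iff:
  fixes i j :: nat
  shows "i \<noteq> j \<and> i div 2 = j div 2 \<longleftrightarrow> j = (if even i then i + 1 else i - 1)"
proof (cases "even i")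
  case True
  then obtain n where "i = 2 * n" ..
  then show ?thesis
    by auto
next
  case False
  then obtain n where "i = 2 * n + 1" ..
  then show ?thesis
    by auto
qed

lemma card_star_or_matching:
  assumes "even q" "i < q"
  shows "card {j. j < q \<and> star_or_matching k c i j} = (if c < k \<and> i = 0 then q - 1 else 1)"
proof (cases "c < k")
  case True
  show ?thesis
  proof (cases "i = 0")
    case True
    have "{j. j < q \<and> star_or_matching k c i j} = {1..<q}"
      using \<open>c < k\<close> True by (auto simp: star_or_matching_def)
    then show ?thesis
      using True \<open>c < k\<close> by simp
  next
    case False
    have "{j. j < q \<and> star_or_matching k c i j} = {0}"
      using \<open>c < k\<close> False assms by (auto simp: star_or_matching_def)
    then show ?thesis
      using False by simp
  qed
next
  case False
  \<comment> \<open>Evenness of \<open>q\<close> matters here: for even \<open>i < q\<close> the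
    partner \<open>i + 1\<close> is still below \<open>q\<close>.\<close>
  have "(if even i then i + 1 else i - 1) < q"
    using assms by (auto elim!: evenE)
  then have "{j. j < q \<and> star_or_matching k c i j} = {if even i then i + 1 else i - 1}"
    using False by (auto simp: star_or_matching_def div2_eq_div2_iff simp del: if_split)
  then show ?thesis
    using False by simp
qed

context net
begin

lemma out_degree_star_or_matching:
  assumes "even q" "c \<le> q" "i < q"
  shows "out_degree (with_proj (amalgam q L (star_or_matching k))) (Ln c i) =
    (if c < k \<and> i = 0 then 2 * q - 1 else q + 1)"
  using assms by (auto simp: out_degree_Ln card_star_or_matching)

lemma rm_graph_amalgam:
  assumes "even q" "1 \<le> k"
  shows "rm_graph (q + 1) (2 * q - 1) 5 (amalgam q L (star_or_matching k))"
    (is "rm_graph _ _ _ ?G")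
proof -
  have sym: "star_or_matching k c i j \<Longrightarrow> star_or_matching k c j i"
    and irrefl: "\<not> star_or_matching k c i i" for c i j
    by (auto simp: star_or_matching_def split: if_splits)
  have "q \<ge> 2"
    using assms q_pos by presburger
  have "girth ?G = 5"
  proof (rule girth_amalgam[OF sym irrefl])
    \<comment> \<open>Along a star edge the property of being 0 flips, so no odd cycle closes up,
      and in a closed walk of length 4 two opposite vertices are 0. In a matching two steps lead
      back to the start.\<close>
    show "\<not> star_or_matching k c l i" if "star_or_matching k c i j" "star_or_matching k c j l"
      for c i j l
      using that by (cases "c < k")
        (auto simp: star_or_matching_def div2_eq_div2_iff elim!: oddE split: if_splits)
    show "i = l \<or> j = m" if "star_or_matching k c i j" "star_or_matching k c j l"
      "star_or_matching k c l m" "star_or_matching k c m i" for c i j l m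
      using that by (cases "c < k")
        (auto simp: star_or_matching_def div2_eq_div2_iff elim!: oddE split: if_splits)
    \<comment> \<open>Class 0 carries a star because \<open>1 \<le> k\<close>; this edge provides
      the pentagon.\<close>
    show "star_or_matching k 0 0 1"
      using assms by (simp add: star_or_matching_def)
  qed (use \<open>q \<ge> 2\<close> in auto)
  moreover have "out_degree (with_proj ?G) ` pverts ?G = {q + 1, 2 * q - 1}"
  proof (intro equalityI subsetI)
    fix x assume "x \<in> out_degree (with_proj ?G) ` pverts ?G"
    then show "x \<in> {q + 1, 2 * q - 1}"
      using assms(1)
      by (auto elim!: amalgam_vert_cases simp: out_degree_Pt out_degree_star_or_matching)
  next
    have "Pt 0 \<in> pverts ?G" "out_degree (with_proj ?G) (Pt 0) = q + 1"
      "Ln 0 0 \<in> pverts ?G" "out_degree (with_proj ?G) (Ln 0 0) = 2 * q - 1"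
      using assms q_pos by (simp_all add: out_degree_Pt out_degree_star_or_matching)
    then show "x \<in> out_degree (with_proj ?G) ` pverts ?G" if "x \<in> {q + 1, 2 * q - 1}" for x
      using that by (metis empty_iff image_eqI insert_iff)
  qed
  ultimately show ?thesis
    using pair_graph_amalgam[of "star_or_matching k", OF sym irrefl]
    by (simp add: rm_graph_def numeral_eq_enat)
qed

text \<open>As \<open>2 < q\<close>, the degrees \<open>q + 1\<close> and \<open>2 * q - 1\<close>
  differ, so only the star centres count; the bound on \<open>k\<close> ensures that all
  \<open>k\<close> classes exist.\<close>

lemma card_max_degree_amalgam:
  assumes "even q" "2 < q" "k \<le> q + 1"
  defines "G \<equiv> amalgam q L (star_or_matching k)"
  shows "card {v \<in> pverts G. out_degree (with_proj G) v = 2 * q - 1} = k"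
proof -
  have "{v \<in> pverts G. out_degree (with_proj G) v = 2 * q - 1} = (\<lambda>c. Ln c 0) ` {..<k}"
    using assms
    by (auto elim!: amalgam_vert_cases simp: out_degree_Pt out_degree_star_or_matching
        split: if_splits)
  then show ?thesis
    by (simp add: card_image inj_on_def)
qed

lemma rm_cage_amalgam:
  assumes "even q" "2 < q" "1 \<le> k"
  shows "rm_cage (q + 1) (2 * q - 1) 5 (amalgam q L (star_or_matching k))"
  unfolding rm_cage_def
proof (intro conjI allI impI)
  fix H :: "nat pair_pre_digraph"
  assume H: "rm_graph (q + 1) (2 * q - 1) 5 H"
  then have deg: "out_degree (with_proj H) ` pverts H = {q + 1, 2 * q - 1}"
    by (simp add: rm_graph_def)
  then obtain v where v: "v \<in> pverts H" "out_degree (with_proj H) v = 2 * q - 1"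
    by (metis imageE insertI1 insert_commute)
  have min: "q + 1 \<le> out_degree (with_proj H) u" if "u \<in> pverts H" for u
  proof -
    have "out_degree (with_proj H) u \<in> {q + 1, 2 * q - 1}"
      using deg that by blast
    then show ?thesis
      using assms by auto
  qed
  have "(2 * q - 1) * (q + 1) + 1 \<le> card (pverts H)"
    using order_ge_of_girth_5[OF _ _ min v(1)] H v(2) by (simp add: rm_graph_def numeral_eq_enat)
  \<comment> \<open>Both sides are \<open>2 * q\<^sup>2 + q\<close>; the left one needs
    \<open>q > 0\<close> because of truncated subtraction.\<close>
  moreover have "(2 * q - 1) * (q + 1) + 1 = q\<^sup>2 + (q + 1) * q"
    using assms by (cases q) (auto simp: power2_eq_square)
  ultimately show "card (pverts (amalgam q L (star_or_matching k))) \<le> card (pverts H)"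
    by (simp add: card_amalgam)
qed (use rm_graph_amalgam assms in auto)

end

section \<open>The family of \<open>q + 1\<close> cages\<close>

theorem theorem3p3:
  fixes q r s :: nat
  assumes "s \<ge> 2"
    and "q = 2 ^ s"
    and "r = q + 1"
  shows "\<exists>\<C> :: nat pair_pre_digraph set.
    finite \<C> \<and> card \<C> \<ge> q + 1 \<and>
    (\<forall>G \<in> \<C>. rm_cage r (2 * r - 3) 5 G) \<and>
    pairwise (\<lambda>G H. \<not> digraph_iso (with_proj G) (with_proj H)) \<C>"
proof -
  have q: "even q" "2 < q"
    using assms(1) power_increasing[of 2 s "2 :: nat"] unfolding assms(2) by simp_all
  obtain L :: "nat \<Rightarrow> nat \<Rightarrow> nat" where
    "\<And>c p. c \<le> q \<Longrightarrow> p < q\<^sup>2 \<Longrightarrow> L c p < q"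
    "\<And>c d. c \<le> q \<Longrightarrow> d \<le> q \<Longrightarrow> c \<noteq> d \<Longrightarrow> inj_on (\<lambda>p. (L c p, L d p)) {..<q\<^sup>2}"
    using ex_orthogonal_array[of s q] assms by auto
  then interpret net q L
    using q by unfold_locales auto
  let ?G = "\<lambda>k. amalgam q L (star_or_matching k)"
  have noniso: "\<not> digraph_iso (with_proj (?G k)) (with_proj (?G l))"
    if "k \<in> {1..q + 1}" "l \<in> {1..q + 1}" "k \<noteq> l" for k l
    using digraph_iso_card_degree[of "with_proj (?G k)" "with_proj (?G l)" "2 * q - 1"]
      card_max_degree_amalgam[OF q, of k] card_max_degree_amalgam[OF q, of l] that by auto
  \<comment> \<open>The graphs must also be distinct as objects for the set to have
    \<open>q + 1\<close> elements; the number of vertices of degree \<open>2 * q - 1\<close>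
    recovers \<open>k\<close>.\<close>
  have "inj_on ?G {1..q + 1}"
  proof (rule inj_onI)
    fix k l assume "k \<in> {1..q + 1}" "l \<in> {1..q + 1}" "?G k = ?G l"
    then show "k = l"
      using card_max_degree_amalgam[OF q, of k] card_max_degree_amalgam[OF q, of l] by simp
  qed
  then have card: "card (?G ` {1..q + 1}) = q + 1"
    by (simp add: card_image)
  have cage: "rm_cage r (2 * r - 3) 5 G" if G: "G \<in> ?G ` {1..q + 1}" for G
  proof -
    obtain k where "1 \<le> k" "G = ?G k"
      using G by auto
    moreover have "2 * r - 3 = 2 * q - 1"
      using assms(3) by simp
    ultimately show ?thesis
      using rm_cage_amalgam[OF q] assms(3) by simp
  qed
  have pairwise: "pairwise (\<lambda>G H. \<not> digraph_iso (with_proj G) (with_proj H)) (?G ` {1..q + 1})"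
  proof (rule pairwiseI)
    fix G H assume GH: "G \<in> ?G ` {1..q + 1}" "H \<in> ?G ` {1..q + 1}" "G \<noteq> H"
    then obtain k l where kl: "k \<in> {1..q + 1}" "G = ?G k" "l \<in> {1..q + 1}" "H = ?G l"
      by blast
    then have "k \<noteq> l"
      using GH(3) by blast
    then show "\<not> digraph_iso (with_proj G) (with_proj H)"
      using noniso kl by blast
  qed
  show ?thesis
  proof (intro exI[of _ "?G ` {1..q + 1}"] conjI ballI)
    show "finite (?G ` {1..q + 1})"
      by (intro finite_imageI finite_atLeastAtMost)
    show "q + 1 \<le> card (?G ` {1..q + 1})"
      unfolding card ..
  qed (fact cage pairwise)+
qed

end
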